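(* Let $n$ be a positive integer and $A\in SL(n,\mathbb{Z})$. Then the group $G=\mathbb{Z}^n\rtimes_A\mathbb{Z}$ is graph automatic.
   Context: $\mathbb{Z}^n\rtimes_A\mathbb{Z}$ is the semidirect product in which a generator $t$ of $\mathbb{Z}$ acts on $\mathbb{Z}^n$ by the automorphism given by the matrix $A$. For a finite alphabet $\Sigma$, let $\Sigma^\star$ be the set of finite strings over $\Sigma$. For strings $w_1,\dots,w_n\in\Sigma^\star$ the convolution $\otimes(w_1,\dots,w_n)$ is the string of length $\max_i|w_i|$ over the alphabet $(\Sigma\cup\{\diamond\})^n$ (with $\diamond\notin\Sigma$) whose $k$-th symbol is $(\sigma_1,\dots,\sigma_n)$, where $\sigma_i$ is the $k$-th symbol of $w_i$ if $k\le|w_i|$ and $\sigma_i=\diamond$ otherwise. A relation $R\subseteq(\Sigma^\star)^n$ is FA recognizable if $\{\otimes(w_1,\dots,w_n)\mid (w_1,\dots,w_n)\in R\}$ is a regular language (recognized by a finite automaton). Let $G$ be a group generated by a finite set $X$. Its Cayley graph $\Gamma(G,X)$ is viewed as the structure $(G;(E_x)_{x\in X})$ with $E_x=\{(g,gx)\mid g\in G\}$. The group $G$ is graph automatic with respect to $X$ if there are a finite alphabet $\Sigma$, a regular language $R\subseteq\Sigma^\star$ and a bijection $\nu:R\to G$ such that for each $x\in X$ the relation $\{(u,v)\in R^2\mid \nu(u)x=\nu(v)\}$ is FA recognizable. A finitely generated group is graph automatic if it is graph automatic with respect to some finite generating set. *)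

theory Defs
  imports
    "HOL-Analysis.Determinants"
    "HOL-Algebra.Bij"
    "HOL-Algebra.Elementary_Groups"
begin

text \<open>The states of the automaton are taken to be natural numbers; as there are only finitely
  many of them, this is no restriction.\<close>

definition regular_language :: "'a set \<Rightarrow> 'a list set \<Rightarrow> bool" where
  "regular_language \<Sigma> L \<longleftrightarrow> finite \<Sigma> \<and>
     (\<exists>(Q :: nat set) q\<^sub>0 \<delta> F.
        finite Q \<and> q\<^sub>0 \<in> Q \<and> F \<subseteq> Q \<and> (\<forall>q\<in>Q. \<forall>a\<in>\<Sigma>. \<delta> q a \<in> Q) \<and>
        L = {w \<in> lists \<Sigma>. foldl \<delta> q\<^sub>0 w \<in> F})"

text \<open>An n-tuple of words is a list of length n; the padding symbol is \<^const>\<open>None\<close>, and the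
  letters of the original alphabet are tagged with \<^const>\<open>Some\<close>.\<close>

definition convolution :: "'a list list \<Rightarrow> 'a option list list" where
  "convolution ws =
     map (\<lambda>k. map (\<lambda>w. if k < length w then Some (w ! k) else None) ws)
       [0..<Max (insert 0 (length ` set ws))]"

definition padded_alphabet :: "'a set \<Rightarrow> nat \<Rightarrow> 'a option list set" where
  "padded_alphabet \<Sigma> n = {\<sigma>. length \<sigma> = n \<and> set \<sigma> \<subseteq> insert None (Some ` \<Sigma>)}"

definition FA_recognizable :: "'a set \<Rightarrow> nat \<Rightarrow> 'a list list set \<Rightarrow> bool" where
  "FA_recognizable \<Sigma> n R \<longleftrightarrow>
     R \<subseteq> {ws. length ws = n \<and> set ws \<subseteq> lists \<Sigma>} \<and>
     regular_language (padded_alphabet \<Sigma> n) (convolution ` R)"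

text \<open>Again, every finite alphabet may be taken to consist of natural numbers.\<close>

definition graph_automatic_wrt :: "('g, 'm) monoid_scheme \<Rightarrow> 'g set \<Rightarrow> bool" where
  "graph_automatic_wrt G X \<longleftrightarrow>
     group G \<and> finite X \<and> X \<subseteq> carrier G \<and> generate G X = carrier G \<and>
     (\<exists>(\<Sigma> :: nat set) R \<nu>.
        finite \<Sigma> \<and> regular_language \<Sigma> R \<and> bij_betw \<nu> R (carrier G) \<and>
        (\<forall>x\<in>X. FA_recognizable \<Sigma> 2
           {[u, v] | u v. u \<in> R \<and> v \<in> R \<and> \<nu> u \<otimes>\<^bsub>G\<^esub> x = \<nu> v}))"

definition graph_automatic :: "('g, 'm) monoid_scheme \<Rightarrow> bool" where
  "graph_automatic G \<longleftrightarrow> (\<exists>X. graph_automatic_wrt G X)"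

definition semidirect_product ::
  "('a, 'm) monoid_scheme \<Rightarrow> ('b, 'k) monoid_scheme \<Rightarrow> ('b \<Rightarrow> 'a \<Rightarrow> 'a) \<Rightarrow> ('a \<times> 'b) monoid" where
  "semidirect_product N H \<phi> =
     \<lparr>carrier = carrier N \<times> carrier H,
      monoid.mult = (\<lambda>(a, h) (b, k). (a \<otimes>\<^bsub>N\<^esub> \<phi> h b, h \<otimes>\<^bsub>H\<^esub> k)),
      one = (\<one>\<^bsub>N\<^esub>, \<one>\<^bsub>H\<^esub>)\<rparr>"

definition int_vec_group :: "(int ^ 'n) monoid" where
  "int_vec_group = \<lparr>carrier = UNIV, monoid.mult = (+), one = 0\<rparr>"

text \<open>The generator \<open>t = (0, 1)\<close> satisfies \<open>t v t\<inverse> = A v\<close>: the integer \<open>k\<close> acts by the \<open>k\<close>-th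
  power of \<open>v \<mapsto> A v\<close>, taken in the automorphism group so that \<open>k\<close> may be negative.
  This is meaningful only if \<open>A\<close> is invertible over the integers.\<close>

definition Zn_semidirect_Z :: "int ^ 'n ^ 'n \<Rightarrow> ((int ^ 'n) \<times> int) monoid" where
  "Zn_semidirect_Z A =
     semidirect_product int_vec_group integer_group
       (\<lambda>k :: int. (\<lambda>v. A *v v) [^]\<^bsub>AutoGroup int_vec_group\<^esub> k)"

end

(* In the coordinates (A^(-k) v, k) of Z^(n+1), right multiplication of (v, k) by a fixed group
   element is an affine map x |-> M x + c, where M does not depend on (v, k). Write the vectors of
   Z^(n+1) as strings of columns of balanced ternary digits, least significant first. An automaton
   reading x and y in parallel verifies M x + c = y by updating the carry c, which stays bounded
   because it is divided by 3 at each step. So the graph of the affine map has finitely many left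
   quotients, which are the states of the automaton. *)

theory Submission
  imports Defs
begin

section \<open>Regularity from finitely many left quotients\<close>

text \<open>This is the Myhill-Nerode construction: the languages in \<open>Q\<close> are the
  states, reading \<open>a\<close> passes from \<open>K\<close> to its quotient by \<open>a\<close>,
  and a state accepts when it contains the empty word. Any finite family closed under quotients will
  do, so it need not be known which of its members are reached from \<open>L\<close>.\<close>

lemma regular_language_if_finite_quotients:
  fixes Q :: "'a list set set"
  assumes "finite \<Sigma>" "finite Q" "L \<in> Q" "L \<subseteq> lists \<Sigma>"
    and quotient: "\<And>K a. K \<in> Q \<Longrightarrow> a \<in> \<Sigma> \<Longrightarrow> {w. a # w \<in> K} \<in> Q"
  shows "regular_language \<Sigma> L"
proof -
  \<comment> \<open>States have to be natural numbers, so each language in \<open>Q\<close> is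
    replaced by a code.\<close>
  obtain f :: "'a list set \<Rightarrow> nat" where f: "inj_on f Q"
    using finite_imp_inj_to_nat_seg[OF \<open>finite Q\<close>] by blast
  define \<delta> where "\<delta> q a = f {w. a # w \<in> inv_into Q f q}" for q a
  have \<delta>: "\<delta> (f K) a = f {w. a # w \<in> K}" if "K \<in> Q" for K a
    using that f by (simp add: \<delta>_def)
  have run: "K \<in> Q \<Longrightarrow> w \<in> lists \<Sigma> \<Longrightarrow>
      {v. w @ v \<in> K} \<in> Q \<and> foldl \<delta> (f K) w = f {v. w @ v \<in> K}" for K w
  proof (induction w arbitrary: K)
    case (Cons a w)
    then show ?case using Cons.IH[OF quotient[of K a]] \<delta>[of K a] by simp
  qed simp
  have "L = {w \<in> lists \<Sigma>. foldl \<delta> (f L) w \<in> f ` {K \<in> Q. [] \<in> K}}"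
  proof -
    have "w \<in> L \<longleftrightarrow> foldl \<delta> (f L) w \<in> f ` {K \<in> Q. [] \<in> K}" if "w \<in> lists \<Sigma>" for w
    proof -
      let ?K = "{v. w @ v \<in> L}"
      have "?K \<in> Q" "foldl \<delta> (f L) w = f ?K" using run[OF \<open>L \<in> Q\<close> that] by auto
      \<comment> \<open>Injectivity of \<open>f\<close> on \<open>Q\<close> keeps an accepting
        language from sharing its code with a rejecting one.\<close>
      moreover have "f ?K \<in> f ` {K \<in> Q. [] \<in> K} \<longleftrightarrow> [] \<in> ?K"
        using inj_on_image_mem_iff[OF f \<open>?K \<in> Q\<close>, of "{K \<in> Q. [] \<in> K}"] \<open>?K \<in> Q\<close> by auto
      ultimately show ?thesis by simp
    qed
    then show ?thesis using \<open>L \<subseteq> lists \<Sigma>\<close> by blast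
  qed
  moreover have "\<forall>q\<in>f ` Q. \<forall>a\<in>\<Sigma>. \<delta> q a \<in> f ` Q" using \<delta> quotient by auto
  ultimately show ?thesis
    unfolding regular_language_def using assms
    by (intro conjI exI[of _ "f ` Q"] exI[of _ "f L"] exI[of _ \<delta>] exI[of _ "f ` {K \<in> Q. [] \<in> K}"]) auto
qed

section \<open>Convolutions of two words, read column by column\<close>

lemma finite_padded_alphabet: "finite \<Sigma> \<Longrightarrow> finite (padded_alphabet \<Sigma> n)"
  unfolding padded_alphabet_def
  using finite_lists_length_eq[of "insert None (Some ` \<Sigma>)" n] by (simp add: conj_commute)

fun push :: "'a option \<Rightarrow> 'a list \<Rightarrow> 'a list" where
  "push None u = u"
| "push (Some a) u = a # u"

text \<open>Rules out padding in front of a letter: once a tape shows \<open>None\<close>, its word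
  has ended.\<close>

definition pushable :: "'a option \<Rightarrow> 'a list \<Rightarrow> bool" where
  "pushable x u \<longleftrightarrow> (x = None \<longrightarrow> u = [])"

lemma convolution2:
  "convolution [u, v] = map (\<lambda>k. [if k < length u then Some (u ! k) else None,
     if k < length v then Some (v ! k) else None]) [0..<max (length u) (length v)]"
  by (simp add: convolution_def)

lemma convolution_Nil: "convolution [u, v] = [] \<longleftrightarrow> u = [] \<and> v = []"
  by (auto simp: convolution2)

text \<open>A column of two padding symbols is excluded because a convolution is only as long as the
  longer word.\<close>

lemma convolution_push:
  assumes "pushable x u" "pushable y v" "x \<noteq> None \<or> y \<noteq> None"
  shows "convolution [push x u, push y v] = [x, y] # convolution [u, v]"
proof -
  have "max (length (push x u)) (length (push y v)) = Suc (max (length u) (length v))"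
    using assms by (cases x; cases y) (auto simp: pushable_def)
  then show ?thesis
    unfolding convolution2 using assms
    by (cases x; cases y) (auto simp: pushable_def upt_conv_Cons map_Suc_upt[symmetric] simp del: upt_Suc)
qed

lemma pushable_cases:
  obtains x u' where "u = push x u'" "pushable x u'" "x = None \<longleftrightarrow> u = []"
proof (cases u)
  case Nil
  then show ?thesis by (intro that[of None "[]"]) (auto simp: pushable_def)
next
  case (Cons a u')
  then show ?thesis by (intro that[of "Some a" u']) (auto simp: pushable_def)
qed

text \<open>Decomposes a convolution at its first column, which turns left quotients of a set of
  convolutions into separate conditions on the two tapes.\<close>

lemma convolution_eq_Cons:
  "convolution [u, v] = \<sigma> # W \<longleftrightarrow>
    (\<exists>x y u' v'. \<sigma> = [x, y] \<and> (x \<noteq> None \<or> y \<noteq> None) \<and> u = push x u' \<and> v = push y v' \<and>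
       pushable x u' \<and> pushable y v' \<and> convolution [u', v'] = W)" (is "?l \<longleftrightarrow> ?r")
proof
  assume l: ?l
  obtain x u' where u: "u = push x u'" "pushable x u'" "x = None \<longleftrightarrow> u = []" by (rule pushable_cases)
  obtain y v' where v: "v = push y v'" "pushable y v'" "y = None \<longleftrightarrow> v = []" by (rule pushable_cases)
  have "x \<noteq> None \<or> y \<noteq> None" using l u(3) v(3) convolution_Nil[of u v] by auto
  then show ?r using convolution_push[of x u' y v'] u v l by auto
next
  assume ?r
  then show ?l using convolution_push by blast
qed

lemma convolution_in_lists:
  "u \<in> lists \<Sigma> \<Longrightarrow> v \<in> lists \<Sigma> \<Longrightarrow> convolution [u, v] \<in> lists (padded_alphabet \<Sigma> 2)"
  by (auto simp: convolution2 padded_alphabet_def)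

definition left_quotient :: "'a option \<Rightarrow> 'a list set \<Rightarrow> 'a list set" where
  "left_quotient x S = {u. pushable x u \<and> push x u \<in> S}"

lemma left_quotient_convolution:
  "{W. [x, y] # W \<in> {convolution [u, v] |u v. u \<in> S \<and> v \<in> T \<and> P u v}} =
    {convolution [u, v] |u v. (x \<noteq> None \<or> y \<noteq> None) \<and> u \<in> left_quotient x S \<and> v \<in> left_quotient y T \<and>
       P (push x u) (push y v)}"
    (is "?l = ?r")
proof -
  \<comment> \<open>The equation is turned around so that \<open>convolution_eq_Cons\<close> can
    rewrite it.\<close>
  have "W \<in> ?l \<longleftrightarrow> (\<exists>u v. convolution [u, v] = [x, y] # W \<and> u \<in> S \<and> v \<in> T \<and> P u v)" for W
    by (simp only: mem_Collect_eq) metis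
  then show ?thesis
    by (auto simp: convolution_eq_Cons left_quotient_def)
qed

section \<open>Balanced ternary numerals for integer vectors\<close>

text \<open>Serves both for the digit columns and for the bounded carries.\<close>

lemma finite_vec_componentwise:
  assumes "finite I"
  shows "finite {x :: 'a ^ 'm. \<forall>i. x $ i \<in> I}"
proof (rule finite_surj)
  show "finite ((UNIV :: 'm set) \<rightarrow>\<^sub>E I)" using assms by (intro finite_PiE) auto
  show "{x :: 'a ^ 'm. \<forall>i. x $ i \<in> I} \<subseteq> vec_lambda ` (UNIV \<rightarrow>\<^sub>E I)"
  proof
    fix x :: "'a ^ 'm" assume "x \<in> {x. \<forall>i. x $ i \<in> I}"
    then have "vec_nth x \<in> UNIV \<rightarrow>\<^sub>E I" by auto
    then show "x \<in> vec_lambda ` (UNIV \<rightarrow>\<^sub>E I)" by (metis image_eqI vec_nth_inverse)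
  qed
qed

text \<open>One letter encodes a whole column, with a digit for every coordinate. The letters are
  kept abstract because the alphabet finally consists of natural numbers. Balanced digits represent
  negative integers without a sign.\<close>

locale balanced_ternary =
  fixes \<Sigma> :: "'a set" and digit :: "'a \<Rightarrow> int ^ 'm"
  assumes digit: "bij_betw digit \<Sigma> {d. \<forall>i. d $ i \<in> {-1, 0, 1}}"
begin

fun val :: "'a list \<Rightarrow> int ^ 'm" where
  "val [] = 0"
| "val (a # u) = digit a + 3 *s val u"

definition reduced_words :: "'a list set" where
  "reduced_words = {u \<in> lists \<Sigma>. u \<noteq> [] \<longrightarrow> digit (last u) \<noteq> 0}"

lemma finite_alphabet: "finite \<Sigma>"
  using bij_betw_finite[OF digit] finite_vec_componentwise[of "{-1, 0, 1}"] by simp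

lemma digit_range: "a \<in> \<Sigma> \<Longrightarrow> digit a $ i \<in> {-1, 0, 1}"
  using bij_betwE[OF digit] by auto

lemma obtain_digit:
  fixes d :: "int ^ 'm"
  assumes "\<And>i. d $ i \<in> {-1, 0, 1}"
  obtains a where "a \<in> \<Sigma>" "digit a = d"
proof -
  have "d \<in> digit ` \<Sigma>" using digit assms by (simp add: bij_betw_def)
  then show ?thesis using that by blast
qed

text \<open>The digits -1, 0, 1 are pairwise incongruent modulo 3, so each coordinate of the
  equation determines its digit, and then the rest.\<close>

lemma digit_eq_if_cong:
  assumes "a \<in> \<Sigma>" "b \<in> \<Sigma>" "digit a + 3 *s x = digit b + 3 *s y"
  shows "a = b \<and> x = y"
proof -
  have eq: "digit a $ i + 3 * x $ i = digit b $ i + 3 * y $ i" for i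
    using arg_cong[OF assms(3), of "\<lambda>v. v $ i"] by simp
  have "digit a $ i = digit b $ i \<and> x $ i = y $ i" for i
    using eq[of i] digit_range[OF assms(1), of i] digit_range[OF assms(2), of i] by auto presburger+
  then have "digit a = digit b" "x = y" by (simp_all add: vec_eq_iff)
  then show ?thesis using digit assms(1,2) by (auto simp: bij_betw_def inj_on_def)
qed

lemma reduced_words_Cons: "a # u \<in> reduced_words \<longleftrightarrow> a \<in> \<Sigma> \<and> u \<in> reduced_words \<and> (u = [] \<longrightarrow> digit a \<noteq> 0)"
  by (auto simp: reduced_words_def)

lemma Nil_in_reduced_words: "[] \<in> reduced_words"
  by (simp add: reduced_words_def)

lemma val_eq_0: "u \<in> reduced_words \<Longrightarrow> val u = 0 \<Longrightarrow> u = []"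
proof (induction u)
  case (Cons a u)
  obtain z where z: "z \<in> \<Sigma>" "digit z = 0" using obtain_digit[of 0] by auto
  have "a = z \<and> val u = 0"
    using Cons.prems z by (intro digit_eq_if_cong) (auto simp: reduced_words_Cons)
  then show ?case using Cons z by (auto simp: reduced_words_Cons)
qed simp

lemma inj_on_val: "inj_on val reduced_words"
proof -
  have "u \<in> reduced_words \<Longrightarrow> v \<in> reduced_words \<Longrightarrow> val u = val v \<Longrightarrow> u = v" for u v
  proof (induction u arbitrary: v)
    case Nil
    then show ?case using val_eq_0[of v] by simp
  next
    case (Cons a u)
    show ?case
    proof (cases v)
      case Nil
      then show ?thesis using val_eq_0[OF Cons.prems(1)] Cons.prems by simp
    next
      case v: (Cons b v')
      then show ?thesis
        using Cons digit_eq_if_cong[of a b "val u" "val v'"] by (auto simp: reduced_words_Cons)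
    qed
  qed
  then show ?thesis by (auto intro: inj_onI)
qed

lemma val_surj: "\<exists>u \<in> reduced_words. val u = x"
proof (induction "\<Sum>i\<in>UNIV. nat \<bar>x $ i\<bar>" arbitrary: x rule: less_induct)
  case less
  show ?case
  proof (cases "x = 0")
    case True
    then show ?thesis using Nil_in_reduced_words by force
  next
    case False
    \<comment> \<open>Shifting by 1 before and after reduction modulo 3 yields a remainder in -1, 0,
      1; \<open>y\<close> is \<open>x / 3\<close> rounded to the nearest integer.\<close>
    define d y where "d = (\<chi> i. (x $ i + 1) mod 3 - 1)" and "y = (\<chi> i. (x $ i + 1) div 3)"
    have nth: "x $ i = d $ i + 3 * y $ i" "-1 \<le> d $ i" "d $ i \<le> 1" for i
      using div_mult_mod_eq[of "x $ i + 1" 3] pos_mod_sign[of 3 "x $ i + 1"]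
        pos_mod_bound[of 3 "x $ i + 1"]
      unfolding d_def y_def vec_lambda_beta by linarith+
    then have x: "x = d + 3 *s y" by (simp add: vec_eq_iff)
    have "d $ i \<in> {-1, 0, 1}" for i using nth(2,3)[of i] by auto
    then obtain a where a: "a \<in> \<Sigma>" "digit a = d" using obtain_digit by blast
    \<comment> \<open>Rounding \<open>x / 3\<close> strictly decreases the absolute value of every
      nonzero coordinate, so the sum of absolute values serves as induction measure.\<close>
    have le: "nat \<bar>y $ i\<bar> \<le> nat \<bar>x $ i\<bar>" and less': "x $ i \<noteq> 0 \<Longrightarrow> nat \<bar>y $ i\<bar> < nat \<bar>x $ i\<bar>" for i
      using nth[of i] by linarith+
    obtain i where "x $ i \<noteq> 0" using False by (auto simp: vec_eq_iff)
    then have "(\<Sum>i\<in>UNIV. nat \<bar>y $ i\<bar>) < (\<Sum>i\<in>UNIV. nat \<bar>x $ i\<bar>)"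
      using le less' by (intro sum_strict_mono_ex1) auto
    then obtain u where u: "u \<in> reduced_words" "val u = y" using less by blast
    then have "val (a # u) = x" using a x by simp
    \<comment> \<open>If no further column follows, then \<open>y = 0\<close> and \<open>d\<close>
      is the nonzero vector \<open>x\<close> itself.\<close>
    moreover have "u = [] \<Longrightarrow> d \<noteq> 0" using u x False by auto
    ultimately show ?thesis using u a by (metis reduced_words_Cons)
  qed
qed

lemma bij_betw_val: "bij_betw val reduced_words UNIV"
proof -
  have "x \<in> val ` reduced_words" for x using val_surj[of x] by blast
  then show ?thesis unfolding bij_betw_def using inj_on_val by blast
qed

text \<open>Two states suffice: after a zero column the word must go on, which removes
  \<open>[]\<close>; after any other column it may stop.\<close>

lemma regular_reduced_words: "regular_language \<Sigma> reduced_words"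
proof (rule regular_language_if_finite_quotients)
  show "reduced_words \<in> {reduced_words, reduced_words - {[]}}" by simp
  show "{w. a # w \<in> K} \<in> {reduced_words, reduced_words - {[]}}" if "K \<in> {reduced_words, reduced_words - {[]}}" "a \<in> \<Sigma>" for K a
    using that by (cases "digit a = 0") (auto simp: reduced_words_Cons)
qed (auto simp: finite_alphabet reduced_words_def)

section \<open>Verifying affine maps with bounded carries\<close>

text \<open>Padding counts as the digit 0, so that \<open>val_push\<close> has the same form for
  letters and padding.\<close>

fun padded_digit :: "'a option \<Rightarrow> int ^ 'm" where
  "padded_digit None = 0"
| "padded_digit (Some a) = digit a"

lemma val_push: "pushable x u \<Longrightarrow> val (push x u) = padded_digit x + 3 *s val u"
  by (cases x) (auto simp: pushable_def)

lemma padded_digit_range: "x \<in> insert None (Some ` \<Sigma>) \<Longrightarrow> padded_digit x $ i \<in> {-1, 0, 1}"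
  using digit_range[of "the x" i] by (cases x) auto

text \<open>In each coordinate the new carry is at most \<open>(m + K + 1) / 3\<close> in absolute
  value, where \<open>m\<close> bounds the entry of \<open>M (padded_digit x)\<close>. Choosing
  \<open>K\<close> with \<open>m + 1 \<le> K\<close> makes this at most \<open>2 * K / 3\<close>.
  Such a \<open>K\<close> exists because there are only finitely many digit columns.\<close>

lemma carry_bound:
  fixes M :: "int ^ 'm \<Rightarrow> int ^ 'm"
  obtains K where "\<And>i. \<bar>c $ i\<bar> \<le> K"
    "\<And>x y c' c'' i. x \<in> insert None (Some ` \<Sigma>) \<Longrightarrow> y \<in> insert None (Some ` \<Sigma>) \<Longrightarrow>
      \<bar>c' $ i\<bar> \<le> K \<Longrightarrow> M (padded_digit x) + c' - padded_digit y = 3 *s c'' \<Longrightarrow> \<bar>c'' $ i\<bar> \<le> K"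
proof -
  let ?P = "insert None (Some ` \<Sigma>)"
  \<comment> \<open>The first set admits the initial carry; in the second, the added 1 accounts for
    the digit of \<open>y\<close>.\<close>
  define Z where "Z = (\<lambda>i. \<bar>c $ i\<bar>) ` UNIV \<union> (\<lambda>(x, i). \<bar>M (padded_digit x) $ i\<bar> + 1) ` (?P \<times> UNIV)"
  have fin: "finite Z" using finite_alphabet by (auto simp: Z_def)
  show ?thesis
  proof (rule that[of "Max Z"])
    show "\<bar>c $ i\<bar> \<le> Max Z" for i using fin by (auto simp: Z_def intro!: Max_ge)
    fix x y c' c'' i
    assume xy: "x \<in> ?P" "y \<in> ?P" and c': "\<bar>c' $ i\<bar> \<le> Max Z"
      and eq: "M (padded_digit x) + c' - padded_digit y = 3 *s c''"
    have "\<bar>M (padded_digit x) $ i\<bar> + 1 \<le> Max Z"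
      using fin xy by (intro Max_ge) (auto simp: Z_def)
    moreover have "\<bar>padded_digit y $ i\<bar> \<le> 1" using padded_digit_range[OF xy(2), of i] by auto
    moreover have "M (padded_digit x) $ i + c' $ i - padded_digit y $ i = 3 * c'' $ i"
      using arg_cong[OF eq, of "\<lambda>v. v $ i"] by simp
    ultimately show "\<bar>c'' $ i\<bar> \<le> Max Z" using c' by linarith
  qed
qed

text \<open>A state of the automaton: \<open>S\<close> and \<open>T\<close> are the words still
  allowed on the two tapes, and \<open>c\<close> is the current carry. This generality closes the
  family under left quotients.\<close>

definition affine_graph ::
  "(int ^ 'm \<Rightarrow> int ^ 'm) \<Rightarrow> 'a list set \<Rightarrow> 'a list set \<Rightarrow> int ^ 'm \<Rightarrow> 'a option list list set" where
  "affine_graph M S T c = {convolution [u, v] |u v. u \<in> S \<and> v \<in> T \<and> M (val u) + c = val v}"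

text \<open>With first digits d, e and remaining values p, q, the equation M(d + 3p) + c = e + 3q
  says M d + c - e = 3(q - M p). Either the left side is not divisible by 3 and nothing can follow,
  or its third part is the next carry. A column of padding alone also leaves nothing.\<close>

lemma left_quotient_affine_graph:
  assumes add: "\<And>x y. M (x + y) = M x + M y"
  shows "{W. [x, y] # W \<in> affine_graph M S T c} = {} \<or>
    (\<exists>c'. M (padded_digit x) + c - padded_digit y = 3 *s c' \<and>
      {W. [x, y] # W \<in> affine_graph M S T c} = affine_graph M (left_quotient x S) (left_quotient y T) c')"
proof -
  let ?d = "M (padded_digit x) + c - padded_digit y"
  \<comment> \<open>Additivity of \<open>M\<close> yields compatibility with the factor 3 through
    this sum.\<close>
  have three: "3 *s z = z + z + z" for z :: "int ^ 'm" by (simp add: vec_eq_iff)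
  have M3: "M (3 *s z) = 3 *s M z" for z by (simp only: three add)
  have iff: "M (val (push x u)) + c = val (push y v) \<longleftrightarrow> ?d = 3 *s (val v - M (val u))"
    if "u \<in> left_quotient x S" "v \<in> left_quotient y T" for u v
    using that by (auto simp: left_quotient_def val_push add M3 vector_ssub_ldistrib algebra_simps)
  have q: "{W. [x, y] # W \<in> affine_graph M S T c} =
    {convolution [u, v] |u v. (x \<noteq> None \<or> y \<noteq> None) \<and> u \<in> left_quotient x S \<and> v \<in> left_quotient y T \<and>
       M (val (push x u)) + c = val (push y v)}"
    unfolding affine_graph_def by (rule left_quotient_convolution)
  show ?thesis
  proof (cases "(x \<noteq> None \<or> y \<noteq> None) \<and> (\<exists>c'. ?d = 3 *s c')")
    case False
    then show ?thesis unfolding q using iff by blast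
  next
    case True
    then obtain c' where c': "?d = 3 *s c'" by blast
    have "?d = 3 *s z \<longleftrightarrow> c' = z" for z unfolding c' by (simp add: vec_eq_iff)
    then have "M (val (push x u)) + c = val (push y v) \<longleftrightarrow> M (val u) + c' = val v"
      if "u \<in> left_quotient x S" "v \<in> left_quotient y T" for u v
      using iff[OF that] by (auto simp: algebra_simps)
    then have "{W. [x, y] # W \<in> affine_graph M S T c} =
        affine_graph M (left_quotient x S) (left_quotient y T) c'"
      unfolding q unfolding affine_graph_def using True by (intro Collect_cong) blast
    then show ?thesis using c' by blast
  qed
qed

text \<open>The left quotients all lie in the finite family indexed by two tape states and a carry
  bounded by \<open>K\<close>.\<close>

lemma FA_recognizable_affine:
  assumes add: "\<And>x y. M (x + y) = M x + M y"
  shows "FA_recognizable \<Sigma> 2 {[u, v] |u v. u \<in> reduced_words \<and> v \<in> reduced_words \<and> M (val u) + c = val v}"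
    (is "FA_recognizable \<Sigma> 2 ?R")
proof -
  let ?P = "insert None (Some ` \<Sigma>)"
  obtain K where K: "\<And>i. \<bar>c $ i\<bar> \<le> K"
    "\<And>x y c' c'' i. x \<in> ?P \<Longrightarrow> y \<in> ?P \<Longrightarrow>
      \<bar>c' $ i\<bar> \<le> K \<Longrightarrow> M (padded_digit x) + c' - padded_digit y = 3 *s c'' \<Longrightarrow> \<bar>c'' $ i\<bar> \<le> K"
    using carry_bound by blast
  \<comment> \<open>On one tape, a zero column leads to \<open>reduced_words - {[]}\<close>, padding
    after a complete word to \<open>{[]}\<close>, and input that cannot be completed to
    \<open>{}\<close>.\<close>
  define \<S> where "\<S> = {reduced_words, reduced_words - {[]}, {[]}, {}}"
  define C where "C = {c :: int ^ 'm. \<forall>i. c $ i \<in> {-K..K}}"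
  \<comment> \<open>The empty language is the dead state, entered when the next carry would not be
    integral.\<close>
  define Q where "Q = insert {} ((\<lambda>(S, T, c). affine_graph M S T c) ` (\<S> \<times> \<S> \<times> C))"
  have \<S>: "left_quotient x S \<in> \<S>" if "S \<in> \<S>" "x \<in> ?P" for x S
  proof (cases x)
    case None
    have "left_quotient x S = S \<inter> {[]}" by (auto simp: left_quotient_def pushable_def None)
    then show ?thesis using that Nil_in_reduced_words by (auto simp: \<S>_def)
  next
    case (Some a)
    have "left_quotient x S = {u. a # u \<in> S}" by (auto simp: left_quotient_def pushable_def Some)
    moreover have "a \<in> \<Sigma>" using that Some by auto
    then have "{u. a # u \<in> S} = (if S \<in> {{}, {[]}} then {} else if digit a = 0 then reduced_words - {[]} else reduced_words)"
      using that by (auto simp: \<S>_def reduced_words_Cons)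
    ultimately show ?thesis by (simp add: \<S>_def)
  qed
  have quot: "{W. \<sigma> # W \<in> L} \<in> Q" if "L \<in> Q" and \<sigma>: "\<sigma> \<in> padded_alphabet \<Sigma> 2" for L \<sigma>
  proof -
    obtain x y where xy: "\<sigma> = [x, y]" "x \<in> ?P" "y \<in> ?P"
      using \<sigma> by (auto simp: padded_alphabet_def numeral_2_eq_2 length_Suc_conv)
    from \<open>L \<in> Q\<close> consider "L = {}" | S T c' where "S \<in> \<S>" "T \<in> \<S>" "c' \<in> C" "L = affine_graph M S T c'"
      by (auto simp: Q_def)
    then show ?thesis
    proof cases
      case 1
      then show ?thesis by (simp add: Q_def)
    next
      case 2
      from left_quotient_affine_graph[of M x y S T c', OF add] show ?thesis
      proof (elim disjE exE conjE)
        assume "{W. [x, y] # W \<in> affine_graph M S T c'} = {}"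
        then show ?thesis using 2 xy by (simp add: Q_def)
      next
        fix c'' assume c'': "M (padded_digit x) + c' - padded_digit y = 3 *s c''"
          and eq: "{W. [x, y] # W \<in> affine_graph M S T c'} = affine_graph M (left_quotient x S) (left_quotient y T) c''"
        have "c'' \<in> C" using K(2)[OF xy(2,3) _ c''] 2(3) by (auto simp: C_def abs_le_iff minus_le_iff)
        then have "affine_graph M (left_quotient x S) (left_quotient y T) c'' \<in> Q"
          unfolding Q_def using 2 \<S> xy
          by (intro insertI2 image_eqI[of _ _ "(left_quotient x S, left_quotient y T, c'')"]) auto
        then show ?thesis using 2 xy eq by simp
      qed
    qed
  qed
  have R: "convolution ` ?R = affine_graph M reduced_words reduced_words c"
    by (auto simp: affine_graph_def)
  have "regular_language (padded_alphabet \<Sigma> 2) (affine_graph M reduced_words reduced_words c)"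
  proof (rule regular_language_if_finite_quotients[OF _ _ _ _ quot])
    have "finite C" unfolding C_def by (rule finite_vec_componentwise) simp
    then show "finite Q" by (simp add: Q_def \<S>_def)
    show "affine_graph M reduced_words reduced_words c \<in> Q" using K(1) by (auto simp: Q_def \<S>_def C_def abs_le_iff minus_le_iff)
    show "affine_graph M reduced_words reduced_words c \<subseteq> lists (padded_alphabet \<Sigma> 2)"
      unfolding affine_graph_def reduced_words_def using convolution_in_lists by blast
  qed (auto intro: finite_padded_alphabet finite_alphabet)
  then show ?thesis unfolding FA_recognizable_def R by (auto simp: reduced_words_def)
qed

end

section \<open>Matrices of determinant 1 over a commutative ring\<close>

lemma det_1_right_inverse:
  fixes A :: "'a::comm_ring_1 ^ 'n ^ 'n"
  assumes "det A = 1"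
  shows "\<exists>B. A ** B = mat 1 \<and> det B = 1"
proof -
  \<comment> \<open>the adjugate of \<open>A\<close>, so that the equation below is the Laplace expansion of a determinant\<close>
  define B :: "'a ^ 'n ^ 'n" where "B = (\<chi> l i. det (\<chi> r. if r = i then axis l 1 else A $ r))"
  have "(\<Sum>l\<in>UNIV. A $ j $ l * B $ l $ i) = (if j = i then 1 else 0)" for i j
  proof -
    have "(\<Sum>l\<in>UNIV. A $ j $ l * B $ l $ i) =
        det (\<chi> r. if r = i then \<Sum>l\<in>UNIV. A $ j $ l *s axis l 1 else A $ r)"
      by (simp add: B_def det_linear_row_sum det_row_mul)
    also have "\<dots> = det (\<chi> r. if r = i then A $ j else A $ r)"
      unfolding basis_expansion ..
    also have "\<dots> = (if j = i then 1 else 0)"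
    proof (cases "j = i")
      case True
      then have "(\<chi> r. if r = i then A $ j else A $ r) = A" by (simp add: vec_eq_iff)
      then show ?thesis using True assms by simp
    next
      case False
      then show ?thesis
        by (simp add: det_identical_rows[of i j] row_def vec_eq_iff)
    qed
    finally show ?thesis .
  qed
  then have AB: "A ** B = mat 1"
    by (simp add: matrix_matrix_mult_def mat_def vec_eq_iff)
  then have "det A * det B = 1" by (metis det_mul det_I)
  then show ?thesis using AB assms by auto
qed

text \<open>The right inverse \<open>B\<close> again has determinant 1, hence a right inverse
  \<open>C\<close>; associativity gives \<open>C = A\<close>, so \<open>B\<close> is a two-sided
  inverse.\<close>

lemma det_1_bij:
  fixes A :: "'a::comm_ring_1 ^ 'n ^ 'n"
  assumes "det A = 1"
  shows "bij ((*v) A)"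
proof -
  obtain B where B: "A ** B = mat 1" "det B = 1" using det_1_right_inverse[OF assms] by blast
  obtain C where C: "B ** C = mat 1" using det_1_right_inverse[OF B(2)] by blast
  have "C = A" using B(1) C by (metis matrix_mul_assoc matrix_mul_lid matrix_mul_rid)
  then have "B *v (A *v x) = x" "A *v (B *v x) = x" for x
    using B(1) C by (simp_all add: matrix_vector_mul_assoc)
  then show ?thesis by (intro o_bij[of "(*v) B"]) (auto simp: fun_eq_iff)
qed

section \<open>The action by powers of the matrix and the semidirect product\<close>

lemma group_int_vec_group: "group (int_vec_group :: (int ^ 'n) monoid)"
proof (rule groupI)
  fix x :: "int ^ 'n" assume "x \<in> carrier int_vec_group"
  show "\<exists>y\<in>carrier int_vec_group. y \<otimes>\<^bsub>int_vec_group\<^esub> x = \<one>\<^bsub>int_vec_group\<^esub>"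
    by (rule bexI[of _ "- x"]) (simp_all add: int_vec_group_def)
qed (simp_all add: int_vec_group_def algebra_simps)

text \<open>Gives the negative powers of the matrix action their meaning; bijectivity comes from the
  determinant.\<close>

lemma matrix_in_AutoGroup:
  fixes A :: "int ^ 'n ^ 'n"
  assumes "det A = 1"
  shows "(\<lambda>v. A *v v) \<in> carrier (AutoGroup int_vec_group)"
  using det_1_bij[OF assms]
  by (auto simp: AutoGroup_def auto_def hom_def Bij_def int_vec_group_def extensional_def
      matrix_vector_right_distrib)

definition power_action :: "int ^ 'n ^ 'n \<Rightarrow> int \<Rightarrow> int ^ 'n \<Rightarrow> int ^ 'n" where
  "power_action A k = (\<lambda>v. A *v v) [^]\<^bsub>AutoGroup int_vec_group\<^esub> k"

lemma carrier_Zn_semidirect_Z: "carrier (Zn_semidirect_Z A) = UNIV"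
  and mult_Zn_semidirect_Z: "(a, h) \<otimes>\<^bsub>Zn_semidirect_Z A\<^esub> (b, k) = (a + power_action A h b, h + k)"
  and one_Zn_semidirect_Z: "\<one>\<^bsub>Zn_semidirect_Z A\<^esub> = (0, 0)"
  by (simp_all add: Zn_semidirect_Z_def semidirect_product_def int_vec_group_def power_action_def)

text \<open>The library product is composition restricted to the carrier; here the carrier is the
  whole type, so it is plain composition.\<close>

lemma mult_AutoGroup:
  fixes f g :: "int ^ 'n \<Rightarrow> int ^ 'n"
  assumes "f \<in> carrier (AutoGroup int_vec_group)" "g \<in> carrier (AutoGroup int_vec_group)"
  shows "f \<otimes>\<^bsub>AutoGroup int_vec_group\<^esub> g = f \<circ> g"
  using assms
  by (auto simp: AutoGroup_def auto_def BijGroup_def int_vec_group_def compose_def fun_eq_iff)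

lemma power_action_in_AutoGroup:
  "det A = 1 \<Longrightarrow> power_action A k \<in> carrier (AutoGroup int_vec_group)"
  unfolding power_action_def
  by (intro group.int_pow_closed group.AutoGroup group_int_vec_group matrix_in_AutoGroup)

lemma power_action_0: "power_action A 0 v = v"
  by (simp add: power_action_def AutoGroup_def BijGroup_def int_vec_group_def)

lemma power_action_add_exponent:
  assumes "det A = 1"
  shows "power_action A (h + k) v = power_action A h (power_action A k v)"
proof -
  have "power_action A (h + k) = power_action A h \<otimes>\<^bsub>AutoGroup int_vec_group\<^esub> power_action A k"
    unfolding power_action_def
    by (intro group.int_pow_mult group.AutoGroup group_int_vec_group matrix_in_AutoGroup assms)
  then show ?thesis using mult_AutoGroup power_action_in_AutoGroup assms by (metis comp_apply)
qed

lemma power_action_add: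
  "det A = 1 \<Longrightarrow> power_action A k (v + w) = power_action A k v + power_action A k w"
  using power_action_in_AutoGroup[of A k]
  by (auto simp: AutoGroup_def auto_def hom_def int_vec_group_def)

lemma power_action_zero: "det A = 1 \<Longrightarrow> power_action A k 0 = 0"
  using power_action_add[of A k 0 0] by simp

lemma power_action_inverse:
  assumes "det A = 1"
  shows "power_action A k (power_action A (-k) v) = v" "power_action A (-k) (power_action A k v) = v"
  using power_action_add_exponent[OF assms, of k "-k" v] power_action_add_exponent[OF assms, of "-k" k v]
  by (simp_all add: power_action_0)

lemma group_Zn_semidirect_Z:
  assumes "det A = 1"
  shows "group (Zn_semidirect_Z A)"
proof (rule groupI)
  fix x y z
  show "x \<otimes>\<^bsub>Zn_semidirect_Z A\<^esub> y \<otimes>\<^bsub>Zn_semidirect_Z A\<^esub> z =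
      x \<otimes>\<^bsub>Zn_semidirect_Z A\<^esub> (y \<otimes>\<^bsub>Zn_semidirect_Z A\<^esub> z)"
    by (cases x; cases y; cases z)
      (simp add: mult_Zn_semidirect_Z power_action_add power_action_add_exponent assms algebra_simps)
  show "\<one>\<^bsub>Zn_semidirect_Z A\<^esub> \<otimes>\<^bsub>Zn_semidirect_Z A\<^esub> x = x"
    by (cases x) (simp add: mult_Zn_semidirect_Z one_Zn_semidirect_Z power_action_0)
  obtain a k where x: "x = (a, k)" by fastforce
  show "\<exists>y\<in>carrier (Zn_semidirect_Z A). y \<otimes>\<^bsub>Zn_semidirect_Z A\<^esub> x = \<one>\<^bsub>Zn_semidirect_Z A\<^esub>"
    \<comment> \<open>Multiplying by exponent \<open>-k\<close> from the left applies A^(-k) to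
      \<open>a\<close>, which the first component cancels.\<close>
    by (rule bexI[of _ "(- power_action A (-k) a, -k)"])
      (simp_all add: x mult_Zn_semidirect_Z one_Zn_semidirect_Z carrier_Zn_semidirect_Z)
qed (simp_all add: carrier_Zn_semidirect_Z)

section \<open>A finite generating set\<close>

definition standard_generators :: "((int ^ 'n) \<times> int) set" where
  "standard_generators = insert (0, 1) (range (\<lambda>i. (axis i 1, 0)))"

text \<open>Every element splits as (v, k) = (v, 0)(0, k), where \<open>v\<close> is an integer
  combination of unit vectors and (0, k) is a power of t.\<close>

lemma generate_standard_generators:
  assumes "det A = 1"
  shows "generate (Zn_semidirect_Z A) standard_generators = carrier (Zn_semidirect_Z A)"
proof -
  let ?G = "Zn_semidirect_Z A"
  let ?H = "generate ?G standard_generators"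
  interpret group ?G by (rule group_Zn_semidirect_Z[OF assms])
  have mult: "x \<otimes>\<^bsub>?G\<^esub> y \<in> ?H" if "x \<in> ?H" "y \<in> ?H" for x y
    using that by (rule generate.eng)
  have inv: "inv\<^bsub>?G\<^esub> x \<in> ?H" if "x \<in> ?H" for x
    using that by (intro generate_m_inv_closed) (simp_all add: carrier_Zn_semidirect_Z)
  \<comment> \<open>A homomorphism from the integers stays in \<open>?H\<close> once its value at 1
    does; it is applied to the powers of t and to the multiples of a unit vector.\<close>
  have int_closed: "f k \<in> ?H"
    if f: "\<And>h k. f h \<otimes>\<^bsub>?G\<^esub> f k = f (h + k)" "f 0 = \<one>\<^bsub>?G\<^esub>" "f 1 \<in> ?H" for f :: "int \<Rightarrow> _" and k
  proof -
    have inv1: "inv\<^bsub>?G\<^esub> f 1 = f (-1)"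
      by (rule inv_equality) (simp_all add: f carrier_Zn_semidirect_Z)
    show ?thesis
    proof (induction k rule: int_induct[where k = 0])
      case base
      then show ?case by (simp add: f generate.one)
    next
      case (step1 i)
      then show ?case using mult[OF _ f(3)] by (metis f(1))
    next
      case (step2 i)
      then show ?case using mult[OF _ inv[OF f(3)]] f(1)[of i "-1"] inv1
        by (metis add_uminus_conv_diff)
    qed
  qed
  have t: "(0, k) \<in> ?H" for k
    using int_closed[of "\<lambda>k. (0, k)"] generate.incl[of "(0, 1)" standard_generators ?G]
    by (simp add: mult_Zn_semidirect_Z one_Zn_semidirect_Z power_action_zero assms standard_generators_def)
  have e: "(k *s axis i 1, 0) \<in> ?H" for k i
    using int_closed[of "\<lambda>k. (k *s axis i 1, 0)" k]
      generate.incl[of "(axis i 1, 0)" standard_generators ?G]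
    by (simp add: mult_Zn_semidirect_Z one_Zn_semidirect_Z power_action_0 standard_generators_def
        vector_sadd_rdistrib)
  have "((\<Sum>i\<in>I. v $ i *s axis i 1), 0) \<in> ?H" for v I
  proof (induction I rule: infinite_finite_induct)
    case (insert i I)
    then show ?case
      using mult[OF e[of "v $ i" i] insert.IH] by (simp add: mult_Zn_semidirect_Z power_action_0)
  qed (simp_all add: generate.one flip: one_Zn_semidirect_Z[of A])
  from this[of _ UNIV] have v: "(v, 0) \<in> ?H" for v
    by (simp add: basis_expansion)
  have "(v, k) \<in> ?H" for v k
    using mult[OF v[of v] t[of k]] by (simp add: mult_Zn_semidirect_Z power_action_0)
  then show ?thesis by (auto simp: carrier_Zn_semidirect_Z)
qed

section \<open>Coordinates in Z^(n+1)\<close>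

text \<open>The index type \<open>'n option\<close> adds one coordinate to Z^n; the index
  \<open>None\<close> holds the exponent of t.\<close>

definition join :: "int ^ 'n \<Rightarrow> int \<Rightarrow> int ^ 'n option" where
  "join w k = (\<chi> j. case j of None \<Rightarrow> k | Some i \<Rightarrow> w $ i)"

definition vec_part :: "int ^ 'n option \<Rightarrow> int ^ 'n" where
  "vec_part x = (\<chi> i. x $ Some i)"

lemma join_simps [simp]: "vec_part (join w k) = w" "join w k $ None = k" "join (vec_part x) (x $ None) = x"
  by (auto simp: join_def vec_part_def vec_eq_iff split: option.split)

lemma vec_part_add: "vec_part (x + y) = vec_part x + vec_part y"
  by (simp add: vec_part_def vec_eq_iff)

lemma join_add: "join (w + w') (k + k') = join w k + join w' k'"
  by (simp add: join_def vec_eq_iff split: option.split)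

text \<open>Coordinates (w, k) stand for the product t^k w, with the power of t on the left.\<close>

definition chart :: "int ^ 'n ^ 'n \<Rightarrow> int ^ 'n option \<Rightarrow> (int ^ 'n) \<times> int" where
  "chart A x = (power_action A (x $ None) (vec_part x), x $ None)"

lemma bij_chart:
  assumes "det A = 1"
  shows "bij (chart A)"
proof (rule o_bij)
  show "(\<lambda>(v, k). join (power_action A (-k) v) k) \<circ> chart A = id"
    by (simp add: fun_eq_iff chart_def power_action_inverse assms)
  show "chart A \<circ> (\<lambda>(v, k). join (power_action A (-k) v) k) = id"
    by (simp add: fun_eq_iff chart_def power_action_inverse assms)
qed

text \<open>Writing (b, h) as t^h A^(-h) b and moving t^h past w gives t^k w (b, h) = t^(k+h)
  (A^(-h) w + A^(-h) b). The matrix depends on \<open>h\<close> alone, whereas the original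
  coordinates would involve A^k b, with k varying.\<close>

lemma chart_mult:
  assumes "det A = 1"
  shows "chart A x \<otimes>\<^bsub>Zn_semidirect_Z A\<^esub> (b, h) =
    chart A (join (power_action A (-h) (vec_part x)) (x $ None) + join (power_action A (-h) b) h)"
  using power_action_add_exponent[OF assms, of "x $ None" h]
  by (simp add: chart_def mult_Zn_semidirect_Z power_action_add power_action_inverse assms
      flip: join_add)

theorem proposition13p5:
  fixes A :: "int ^ 'n ^ 'n"
  assumes "det A = 1"
  shows "graph_automatic (Zn_semidirect_Z A)"
proof -
  let ?G = "Zn_semidirect_Z A"
  let ?D = "{d :: int ^ 'n option. \<forall>i. d $ i \<in> {-1, 0, 1}}"
  have "finite ?D" by (rule finite_vec_componentwise) simp
  \<comment> \<open>Letters have to be natural numbers, so the digit columns are enumerated.\<close>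
  then obtain digit where "bij_betw digit {0..<card ?D} ?D"
    using ex_bij_betw_nat_finite by blast
  then interpret balanced_ternary "{0..<card ?D}" digit by unfold_locales
  have bij: "bij_betw (chart A \<circ> val) reduced_words (carrier ?G)"
    using bij_betw_trans[OF bij_betw_val bij_chart[OF assms]] by (simp add: carrier_Zn_semidirect_Z)
  have rec: "FA_recognizable {0..<card ?D} 2
      {[u, v] |u v. u \<in> reduced_words \<and> v \<in> reduced_words \<and> (chart A \<circ> val) u \<otimes>\<^bsub>?G\<^esub> g = (chart A \<circ> val) v}" for g
  proof -
    obtain b h where g: "g = (b, h)" by fastforce
    define M where "M x = join (power_action A (-h) (vec_part x)) (x $ None)" for x
    have "M (x + y) = M x + M y" for x y
      by (simp add: M_def vec_part_add power_action_add assms flip: join_add)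
    \<comment> \<open>Injectivity of \<open>chart A\<close> cancels it on both sides and leaves an
      affine equation between the values.\<close>
    moreover have "(chart A \<circ> val) u \<otimes>\<^bsub>?G\<^esub> g = (chart A \<circ> val) v \<longleftrightarrow>
        M (val u) + join (power_action A (-h) b) h = val v" for u v
      using bij_chart[OF assms]
      by (simp add: g chart_mult assms M_def bij_is_inj inj_eq)
    ultimately show ?thesis by (simp only: FA_recognizable_affine)
  qed
  have "graph_automatic_wrt ?G standard_generators"
    unfolding graph_automatic_wrt_def
  proof (intro conjI exI ballI)
    show "finite (standard_generators :: ((int ^ 'n) \<times> int) set)"
      by (simp add: standard_generators_def)
  qed (use assms bij rec regular_reduced_words in
      \<open>auto simp: group_Zn_semidirect_Z carrier_Zn_semidirect_Z[of A] generate_standard_generators\<close>)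
  then show ?thesis unfolding graph_automatic_def by blast
qed

end
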